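(* Let $M$ be a group. (i) Let $K$ be a normal subgroup of $M$ and let $R$ be a system of representatives of $M/K$ such that $1\in R$. If $\mu: M\to R$ is a map such that $\mu(x)\in Kx$ for every $x\in M$, then the map $s:M\times M\to M\times M$ given by $$s(x,y)=\left(xy,\ \mu(x)^{-1}\mu(xy)\right)\quad\text{for all } x,y\in M$$ is a solution on $M$. (ii) Conversely, if $s(x,y)=(xy,\theta_x(y))$ is a solution on $M$, where $\theta_x:M\to M$ is a map for every $x\in M$, then there exists a normal subgroup $K$ of $M$ such that $\theta_1(M)$ is a system of representatives of $M/K$, $1\in\theta_1(M)$, $\theta_1(x)\in Kx$ for every $x\in M$, and $$s(x,y)=\left(xy,\ \theta_1(x)^{-1}\theta_1(xy)\right)\quad\text{for all } x,y\in M.$$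
   Context: A solution (set-theoretical solution of the pentagon equation) on a set $M$ is a map $s:M\times M\to M\times M$ such that $s_{23}\,s_{13}\,s_{12}=s_{12}\,s_{23}$ as maps $M\times M\times M\to M\times M\times M$ (composition of maps, rightmost applied first), where $s_{12}=s\times \mathrm{id}_M$, $s_{23}=\mathrm{id}_M\times s$, $s_{13}=(\mathrm{id}_M\times\tau)\,s_{12}\,(\mathrm{id}_M\times\tau)$, and $\tau(x,y)=(y,x)$ is the flip map on $M\times M$. Here $xy$ denotes the product in the group $M$, and $1$ denotes its identity, so that $\theta_1$ is the map $\theta_x$ with $x=1$. A system of representatives of $M/K$ is a subset of $M$ containing exactly one element of each coset of $K$ in $M$. *)

theory Defs
  imports "HOL-Algebra.Coset"
begin

text \<open>
  The triple product is \<open>'a \<times> ('a \<times> 'a)\<close>, so \<open>id \<times> s\<close> is \<^const>\<open>map_prod\<close> directly, whereas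
  \<open>s \<times> id\<close> has to be reassociated.
\<close>

definition leg12 :: "('a \<times> 'a \<Rightarrow> 'a \<times> 'a) \<Rightarrow> 'a \<times> 'a \<times> 'a \<Rightarrow> 'a \<times> 'a \<times> 'a" where
  "leg12 s = (\<lambda>(x, y, z). case s (x, y) of (u, v) \<Rightarrow> (u, v, z))"

definition leg23 :: "('a \<times> 'a \<Rightarrow> 'a \<times> 'a) \<Rightarrow> 'a \<times> 'a \<times> 'a \<Rightarrow> 'a \<times> 'a \<times> 'a" where
  "leg23 s = map_prod id s"

definition leg13 :: "('a \<times> 'a \<Rightarrow> 'a \<times> 'a) \<Rightarrow> 'a \<times> 'a \<times> 'a \<Rightarrow> 'a \<times> 'a \<times> 'a" where
  "leg13 s = map_prod id prod.swap \<circ> leg12 s \<circ> map_prod id prod.swap"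

definition pentagon_solution :: "'a set \<Rightarrow> ('a \<times> 'a \<Rightarrow> 'a \<times> 'a) \<Rightarrow> bool" where
  "pentagon_solution A s \<longleftrightarrow>
     s \<in> A \<times> A \<rightarrow> A \<times> A \<and>
     (\<forall>t \<in> A \<times> A \<times> A. (leg23 s \<circ> leg13 s \<circ> leg12 s) t = (leg12 s \<circ> leg23 s) t)"

definition representative_system ::
    "('a, 'b) monoid_scheme \<Rightarrow> 'a set \<Rightarrow> 'a set \<Rightarrow> bool" where
  "representative_system G K R \<longleftrightarrow>
     R \<subseteq> carrier G \<and> (\<forall>C \<in> rcosets\<^bsub>G\<^esub> K. \<exists>!r. r \<in> R \<inter> C)"

end

theory Submission imports Defs begin

text \<open>
  Evaluating the pentagon equation for \<open>s(x,y) = (xy, \<theta>\<^sub>x(y))\<close> on a triple leaves two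
  identities: the cocycle condition \<open>\<theta>\<^sub>x(yz) = \<theta>\<^sub>x(y) \<theta>\<^sub>x\<^sub>y(z)\<close> from the second component, and
  \<open>\<theta>\<^bsub>\<theta>\<^sub>x(y)\<^esub>(\<theta>\<^sub>x\<^sub>y(z)) = \<theta>\<^sub>y(z)\<close> from the third. In a group the cocycle condition at \<open>x = 1\<close> says
  that \<open>\<theta>\<close> is the coboundary \<open>\<theta>\<^sub>x(y) = \<mu>(x)\<^sup>-\<^sup>1 \<mu>(xy)\<close> of \<open>\<mu> = \<theta>\<^sub>1\<close>. For a coboundary the cocycle
  condition is automatic and the other identity collapses to one equation in two variables,
  \<^emph>\<open>transversality\<close>: \<open>\<mu>(\<mu>(x)\<^sup>-\<^sup>1 \<mu>(xy)) = \<mu>(y)\<close> (\<open>pentagon_solution_coboundary_iff\<close>).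

  A map choosing one representative from every coset of a normal subgroup is transversal because
  modulo \<open>K\<close> the argument \<open>\<mu>(x)\<^sup>-\<^sup>1 \<mu>(xy)\<close> is just \<open>y\<close>. Conversely, a transversal \<open>\<mu>\<close> with
  \<open>\<mu>(1) = 1\<close> is idempotent, and its fibre \<open>K = \<mu>\<^sup>-\<^sup>1(1)\<close> acts on the fibres of \<open>\<mu>\<close> from the left:
  \<open>\<mu>(kx) = \<mu>(x)\<close>. On the other hand \<open>\<mu>(x) = \<mu>(y)\<close> forces \<open>x\<^sup>-\<^sup>1 y \<in> K\<close>. The left-right mismatch of
  these two facts is what makes \<open>K\<close> normal, since together they give \<open>x\<^sup>-\<^sup>1 k x \<in> K\<close>; it follows that
  the fibres of \<open>\<mu>\<close> are exactly the cosets of \<open>K\<close>, each containing its own value by idempotence.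
\<close>

context group
begin

text \<open>
  The second entry \<open>\<mu>(x)\<^sup>-\<^sup>1 \<mu>(xy)\<close> of the solution attached to \<open>\<mu>\<close> lies in the same fibre of \<open>\<mu>\<close>
  as \<open>y\<close>.
\<close>

definition transversal_map :: "('a \<Rightarrow> 'a) \<Rightarrow> bool" where
  "transversal_map \<mu> \<longleftrightarrow>
     (\<forall>x \<in> carrier G. \<forall>y \<in> carrier G. \<mu> (inv (\<mu> x) \<otimes> \<mu> (x \<otimes> y)) = \<mu> y)"

lemma pentagon_solution_mult_iff:
  assumes \<theta>: "\<And>x y. x \<in> carrier G \<Longrightarrow> y \<in> carrier G \<Longrightarrow> \<theta> x y \<in> carrier G"
    and s: "\<And>x y. x \<in> carrier G \<Longrightarrow> y \<in> carrier G \<Longrightarrow> s (x, y) = (x \<otimes> y, \<theta> x y)"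
  shows "pentagon_solution (carrier G) s \<longleftrightarrow>
    (\<forall>x \<in> carrier G. \<forall>y \<in> carrier G. \<forall>z \<in> carrier G.
       \<theta> x (y \<otimes> z) = \<theta> x y \<otimes> \<theta> (x \<otimes> y) z \<and> \<theta> (\<theta> x y) (\<theta> (x \<otimes> y) z) = \<theta> y z)"
proof -
  have "s \<in> carrier G \<times> carrier G \<rightarrow> carrier G \<times> carrier G"
    using s \<theta> by auto
  moreover have "(leg23 s \<circ> leg13 s \<circ> leg12 s) (x, y, z) = (leg12 s \<circ> leg23 s) (x, y, z) \<longleftrightarrow>
      \<theta> x (y \<otimes> z) = \<theta> x y \<otimes> \<theta> (x \<otimes> y) z \<and> \<theta> (\<theta> x y) (\<theta> (x \<otimes> y) z) = \<theta> y z"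
    if "x \<in> carrier G" "y \<in> carrier G" "z \<in> carrier G" for x y z
    using that by (auto simp: leg12_def leg13_def leg23_def s \<theta> m_assoc)
  ultimately show ?thesis
    unfolding pentagon_solution_def by auto
qed

text \<open>
  The third component of the pentagon equation carries a free variable \<open>z\<close>, but for a coboundary
  it states that \<open>\<mu>(\<mu>(x)\<^sup>-\<^sup>1 \<mu>(xy))\<^sup>-\<^sup>1 \<mu>(\<mu>(x)\<^sup>-\<^sup>1 \<mu>(xyz))\<close> equals \<open>\<mu>(y)\<^sup>-\<^sup>1 \<mu>(yz)\<close>. Transversality makes
  the factors agree one by one, and \<open>z = y\<^sup>-\<^sup>1\<close> makes the second factors equal to \<open>\<mu>(1)\<close>, so that
  the first factors must agree.
\<close>

lemma pentagon_solution_coboundary_iff: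
  assumes \<mu>: "\<And>x. x \<in> carrier G \<Longrightarrow> \<mu> x \<in> carrier G"
    and s: "\<And>x y. x \<in> carrier G \<Longrightarrow> y \<in> carrier G \<Longrightarrow> s (x, y) = (x \<otimes> y, inv (\<mu> x) \<otimes> \<mu> (x \<otimes> y))"
  shows "pentagon_solution (carrier G) s \<longleftrightarrow> transversal_map \<mu>"
proof -
  let ?\<theta> = "\<lambda>x y. inv (\<mu> x) \<otimes> \<mu> (x \<otimes> y)"
  have cancel: "(inv a \<otimes> b) \<otimes> (inv b \<otimes> c) = inv a \<otimes> c"
    if "a \<in> carrier G" "b \<in> carrier G" "c \<in> carrier G" for a b c
  proof -
    have "b \<otimes> (inv b \<otimes> c) = c"
      using that by (simp add: m_assoc[symmetric])
    then show ?thesis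
      using that by (simp add: m_assoc)
  qed
  have cocycle: "?\<theta> x (y \<otimes> z) = ?\<theta> x y \<otimes> ?\<theta> (x \<otimes> y) z"
    if "x \<in> carrier G" "y \<in> carrier G" "z \<in> carrier G" for x y z
    using that cancel[of "\<mu> x" "\<mu> (x \<otimes> y)" "\<mu> (x \<otimes> y \<otimes> z)"] by (simp add: \<mu> m_assoc)
  have third: "?\<theta> (?\<theta> x y) (?\<theta> (x \<otimes> y) z) =
      inv (\<mu> (?\<theta> x y)) \<otimes> \<mu> (?\<theta> x (y \<otimes> z))"
    if "x \<in> carrier G" "y \<in> carrier G" "z \<in> carrier G" for x y z
    by (rule arg_cong[OF cocycle[OF that, symmetric]])
  have "pentagon_solution (carrier G) s \<longleftrightarrow>
    (\<forall>x \<in> carrier G. \<forall>y \<in> carrier G. \<forall>z \<in> carrier G.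
       ?\<theta> x (y \<otimes> z) = ?\<theta> x y \<otimes> ?\<theta> (x \<otimes> y) z \<and> ?\<theta> (?\<theta> x y) (?\<theta> (x \<otimes> y) z) = ?\<theta> y z)"
    by (rule pentagon_solution_mult_iff) (simp_all add: \<mu> s)
  also have "\<dots> \<longleftrightarrow> (\<forall>x \<in> carrier G. \<forall>y \<in> carrier G. \<forall>z \<in> carrier G.
       inv (\<mu> (?\<theta> x y)) \<otimes> \<mu> (?\<theta> x (y \<otimes> z)) = inv (\<mu> y) \<otimes> \<mu> (y \<otimes> z))"
  proof (intro ball_cong refl)
    fix x y z assume "x \<in> carrier G" "y \<in> carrier G" "z \<in> carrier G"
    note xyz = this
    show "?\<theta> x (y \<otimes> z) = ?\<theta> x y \<otimes> ?\<theta> (x \<otimes> y) z \<and> ?\<theta> (?\<theta> x y) (?\<theta> (x \<otimes> y) z) = ?\<theta> y z \<longleftrightarrow>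
       inv (\<mu> (?\<theta> x y)) \<otimes> \<mu> (?\<theta> x (y \<otimes> z)) = ?\<theta> y z"
      unfolding third[OF xyz] using cocycle[OF xyz] by blast
  qed
  also have "\<dots> \<longleftrightarrow> transversal_map \<mu>"
  proof
    assume *: "\<forall>x \<in> carrier G. \<forall>y \<in> carrier G. \<forall>z \<in> carrier G.
       inv (\<mu> (?\<theta> x y)) \<otimes> \<mu> (?\<theta> x (y \<otimes> z)) = inv (\<mu> y) \<otimes> \<mu> (y \<otimes> z)"
    show "transversal_map \<mu>"
      unfolding transversal_map_def
    proof (intro ballI)
      fix x y assume xy: "x \<in> carrier G" "y \<in> carrier G"
      have "inv (\<mu> (?\<theta> x y)) \<otimes> \<mu> \<one> = inv (\<mu> y) \<otimes> \<mu> \<one>"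
        using *[rule_format, of x y "inv y"] xy by (simp add: \<mu>)
      then have "inv (\<mu> (?\<theta> x y)) = inv (\<mu> y)"
        using xy by (simp add: \<mu>)
      then show "\<mu> (?\<theta> x y) = \<mu> y"
        using xy by (metis \<mu> inv_closed inv_inv m_closed)
    qed
  next
    assume "transversal_map \<mu>"
    then show "\<forall>x \<in> carrier G. \<forall>y \<in> carrier G. \<forall>z \<in> carrier G.
       inv (\<mu> (?\<theta> x y)) \<otimes> \<mu> (?\<theta> x (y \<otimes> z)) = inv (\<mu> y) \<otimes> \<mu> (y \<otimes> z)"
      unfolding transversal_map_def by (metis m_closed)
  qed
  finally show ?thesis .
qed

text \<open>
  Replacing an element by its representative does not change its coset, and cosets of a normal
  subgroup multiply, so \<open>\<mu>(x)\<^sup>-\<^sup>1 \<mu>(xy)\<close> lies in the coset of \<open>x\<^sup>-\<^sup>1 (xy) = y\<close>.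
\<close>

lemma representative_choice_transversal:
  assumes K: "K \<lhd> G" and R: "representative_system G K R"
    and \<mu>R: "\<And>x. x \<in> carrier G \<Longrightarrow> \<mu> x \<in> R"
    and \<mu>K: "\<And>x. x \<in> carrier G \<Longrightarrow> \<mu> x \<in> K #> x"
  shows "transversal_map \<mu>"
proof -
  interpret K: normal K G by (fact K)
  have RG: "R \<subseteq> carrier G"
    and ex1: "\<And>C. C \<in> rcosets K \<Longrightarrow> \<exists>!r. r \<in> R \<inter> C"
    using R by (auto simp: representative_system_def)
  have \<mu>: "\<mu> x \<in> carrier G" if "x \<in> carrier G" for x
    using that \<mu>R RG by blast
  have coset: "K #> \<mu> x = K #> x" if "x \<in> carrier G" for x
    using repr_independence[OF \<mu>K[OF that] that K.is_subgroup] by simp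
  have same: "\<mu> x = \<mu> y" if "x \<in> carrier G" "y \<in> carrier G" "K #> x = K #> y" for x y
  proof -
    have "K #> x \<in> rcosets K"
      using that(1) K.subset by (rule rcosetsI[rotated])
    then show ?thesis
      using ex1[of "K #> x"] that \<mu>R \<mu>K by blast
  qed
  show ?thesis
    unfolding transversal_map_def
  proof (intro ballI)
    fix x y assume xy: "x \<in> carrier G" "y \<in> carrier G"
    have "K #> (inv (\<mu> x) \<otimes> \<mu> (x \<otimes> y)) = set_inv (K #> \<mu> x) <#> (K #> \<mu> (x \<otimes> y))"
      using xy by (simp add: \<mu> K.rcos_inv K.rcos_sum)
    also have "\<dots> = set_inv (K #> x) <#> (K #> (x \<otimes> y))"
      using xy by (simp add: coset)
    also have "\<dots> = K #> (inv x \<otimes> (x \<otimes> y))"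
      using xy by (simp add: K.rcos_inv K.rcos_sum)
    also have "\<dots> = K #> y"
      using xy by (simp add: m_assoc[symmetric])
    finally show "\<mu> (inv (\<mu> x) \<otimes> \<mu> (x \<otimes> y)) = \<mu> y"
      using xy by (intro same) (simp_all add: \<mu>)
  qed
qed

lemma transversal_map_idem:
  assumes "transversal_map \<mu>" "\<mu> \<one> = \<one>" "x \<in> carrier G" "\<mu> x \<in> carrier G"
  shows "\<mu> (\<mu> x) = \<mu> x"
  using assms unfolding transversal_map_def by (metis inv_one l_one one_closed)

text \<open>
  For \<open>k \<in> K\<close> transversality at \<open>k\<close> and \<open>x\<close> reads \<open>\<mu>(\<mu>(kx)) = \<mu>(x)\<close>, so idempotence gives
  invariance under left multiplication by \<open>K\<close>. Transversality at \<open>x\<close> and \<open>x\<^sup>-\<^sup>1 y\<close> reads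
  \<open>\<mu>(\<mu>(x)\<^sup>-\<^sup>1 \<mu>(y)) = \<mu>(x\<^sup>-\<^sup>1 y)\<close>, which puts \<open>x\<^sup>-\<^sup>1 y\<close> into \<open>K\<close> whenever \<open>\<mu>(x) = \<mu>(y)\<close>.
\<close>

lemma transversal_map_fibre:
  assumes \<mu>: "\<And>x. x \<in> carrier G \<Longrightarrow> \<mu> x \<in> carrier G"
    and T: "transversal_map \<mu>" and one: "\<mu> \<one> = \<one>"
  defines "K \<equiv> {k \<in> carrier G. \<mu> k = \<one>}"
  shows "K \<lhd> G" "representative_system G K (\<mu> ` carrier G)"
    "\<And>x. x \<in> carrier G \<Longrightarrow> \<mu> x \<in> K #> x"
proof -
  have trans: "\<mu> (inv (\<mu> x) \<otimes> \<mu> (x \<otimes> y)) = \<mu> y" if "x \<in> carrier G" "y \<in> carrier G" for x y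
    using T that by (simp add: transversal_map_def)
  have idem: "\<mu> (\<mu> x) = \<mu> x" if "x \<in> carrier G" for x
    using T one that by (simp add: transversal_map_idem \<mu>)
  have left_inv: "\<mu> (k \<otimes> x) = \<mu> x" if "k \<in> K" "x \<in> carrier G" for k x
    using that trans[of k x] idem[of "k \<otimes> x"] by (simp add: K_def \<mu>)
  have quot: "inv x \<otimes> y \<in> K" if "x \<in> carrier G" "y \<in> carrier G" "\<mu> x = \<mu> y" for x y
    using that trans[of x "inv x \<otimes> y"] by (simp add: K_def \<mu> one m_assoc[symmetric])
  have sub: "subgroup K G"
  proof (rule subgroupI)
    show "K \<subseteq> carrier G" "K \<noteq> {}"
      using one by (auto simp: K_def)
    show "inv a \<in> K" if "a \<in> K" for a
      using quot[of a \<one>] that one by (simp add: K_def)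
    show "a \<otimes> b \<in> K" if "a \<in> K" "b \<in> K" for a b
      using left_inv[of a b] that by (simp add: K_def)
  qed
  \<comment> \<open>\<open>x\<close> and \<open>k x\<close> have the same value, so their left quotient is in the fibre.\<close>
  have conj: "inv x \<otimes> k \<otimes> x \<in> K" if "x \<in> carrier G" "k \<in> K" for x k
    using quot[of x "k \<otimes> x"] left_inv[of k x] that by (simp add: K_def m_assoc)
  show normal: "K \<lhd> G"
    unfolding normal_inv_iff
  proof (intro conjI ballI sub)
    show "x \<otimes> k \<otimes> inv x \<in> K" if "x \<in> carrier G" "k \<in> K" for x k
      using conj[of "inv x" k] that by simp
  qed
  show own: "\<mu> x \<in> K #> x" if "x \<in> carrier G" for x
  proof -
    \<comment> \<open>Idempotence puts the left quotient of \<open>x\<close> and \<open>\<mu>(x)\<close> into \<open>K\<close>; conjugating it by \<open>x\<close>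
      gives the right quotient that membership in \<open>K x\<close> requires.\<close>
    have "inv (inv x) \<otimes> (inv x \<otimes> \<mu> x) \<otimes> inv x \<in> K"
      using conj[of "inv x"] quot[of x "\<mu> x"] that by (simp add: \<mu> idem)
    then have "\<mu> x \<otimes> inv x \<in> K"
      using that by (simp add: \<mu> m_assoc[symmetric])
    then show ?thesis
      using that by (intro subgroup.rcos_module_rev[OF sub]) (simp_all add: \<mu> is_group)
  qed
  have "\<exists>!r. r \<in> \<mu> ` carrier G \<inter> C" if "C \<in> rcosets K" for C
  proof -
    obtain x where x: "x \<in> carrier G" and C: "C = K #> x"
      using \<open>C \<in> rcosets K\<close> by (auto simp: RCOSETS_def)
    have "\<mu> y = \<mu> x" if y: "y \<in> carrier G" "\<mu> y \<in> K #> x" for y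
    proof -
      obtain k where "k \<in> K" "\<mu> y = k \<otimes> x"
        using y(2) by (auto simp: r_coset_def)
      then show ?thesis
        using left_inv[of k x] idem[of y] x y(1) by metis
    qed
    then show ?thesis
      unfolding C by (intro ex1I[of _ "\<mu> x"]) (use x own[OF x] in blast)+
  qed
  then show "representative_system G K (\<mu> ` carrier G)"
    using \<mu> by (auto simp: representative_system_def)
qed

text \<open>
  The cocycle condition at \<open>(1, x, y)\<close> can be solved for \<open>\<theta>\<^sub>x(y)\<close>; at \<open>(1, 1, 1)\<close> it says that
  \<open>\<theta>\<^sub>1(1)\<close> equals its own square.
\<close>

lemma pentagon_solution_imp_coboundary:
  assumes \<theta>: "\<And>x y. x \<in> carrier G \<Longrightarrow> y \<in> carrier G \<Longrightarrow> \<theta> x y \<in> carrier G"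
    and s: "\<And>x y. x \<in> carrier G \<Longrightarrow> y \<in> carrier G \<Longrightarrow> s (x, y) = (x \<otimes> y, \<theta> x y)"
    and sol: "pentagon_solution (carrier G) s"
  shows "\<theta> \<one> \<one> = \<one>"
    and "\<And>x y. x \<in> carrier G \<Longrightarrow> y \<in> carrier G \<Longrightarrow> \<theta> x y = inv (\<theta> \<one> x) \<otimes> \<theta> \<one> (x \<otimes> y)"
proof -
  have cocycle: "\<theta> x (y \<otimes> z) = \<theta> x y \<otimes> \<theta> (x \<otimes> y) z"
    if "x \<in> carrier G" "y \<in> carrier G" "z \<in> carrier G" for x y z
    using sol pentagon_solution_mult_iff[of \<theta> s] \<theta> s that by blast
  show "\<theta> \<one> \<one> = \<one>"
    using cocycle[of \<one> \<one> \<one>] \<theta>[of \<one> \<one>] by simp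
  show "\<theta> x y = inv (\<theta> \<one> x) \<otimes> \<theta> \<one> (x \<otimes> y)" if "x \<in> carrier G" "y \<in> carrier G" for x y
    using that cocycle[of \<one> x y] by (simp add: \<theta> m_assoc[symmetric])
qed

end

theorem theorem15:
  fixes M :: "('a, 'b) monoid_scheme" (structure)
  assumes "group M"
  shows
    "(\<forall>K R \<mu> s.
        K \<lhd> M \<longrightarrow>
        representative_system M K R \<longrightarrow>
        \<one> \<in> R \<longrightarrow>
        \<mu> \<in> carrier M \<rightarrow> R \<longrightarrow>
        (\<forall>x \<in> carrier M. \<mu> x \<in> K #> x) \<longrightarrow>
        (\<forall>x \<in> carrier M. \<forall>y \<in> carrier M. s (x, y) = (x \<otimes> y, inv (\<mu> x) \<otimes> \<mu> (x \<otimes> y))) \<longrightarrow>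
        pentagon_solution (carrier M) s)
     \<and>
     (\<forall>s \<theta>.
        (\<forall>x \<in> carrier M. \<theta> x \<in> carrier M \<rightarrow> carrier M) \<longrightarrow>
        (\<forall>x \<in> carrier M. \<forall>y \<in> carrier M. s (x, y) = (x \<otimes> y, \<theta> x y)) \<longrightarrow>
        pentagon_solution (carrier M) s \<longrightarrow>
        (\<exists>K. K \<lhd> M \<and>
             representative_system M K (\<theta> \<one> ` carrier M) \<and>
             \<one> \<in> \<theta> \<one> ` carrier M \<and>
             (\<forall>x \<in> carrier M. \<theta> \<one> x \<in> K #> x) \<and>
             (\<forall>x \<in> carrier M. \<forall>y \<in> carrier M.
                s (x, y) = (x \<otimes> y, inv (\<theta> \<one> x) \<otimes> \<theta> \<one> (x \<otimes> y)))))"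
proof (intro conjI allI impI)
  interpret group M by (fact assms)
  fix K R \<mu> s
  assume K: "K \<lhd> M" and R: "representative_system M K R" and "\<mu> \<in> carrier M \<rightarrow> R"
    and \<mu>K: "\<forall>x \<in> carrier M. \<mu> x \<in> K #> x"
    and s: "\<forall>x \<in> carrier M. \<forall>y \<in> carrier M. s (x, y) = (x \<otimes> y, inv (\<mu> x) \<otimes> \<mu> (x \<otimes> y))"
  then have \<mu>R: "\<mu> x \<in> R" if "x \<in> carrier M" for x
    using that by blast
  then have "\<mu> x \<in> carrier M" if "x \<in> carrier M" for x
    using that R by (auto simp: representative_system_def)
  moreover have "transversal_map \<mu>"
    using K R \<mu>R \<mu>K by (intro representative_choice_transversal) auto
  ultimately show "pentagon_solution (carrier M) s"
    using pentagon_solution_coboundary_iff[of \<mu> s] s by simp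
next
  interpret group M by (fact assms)
  fix s \<theta>
  assume "\<forall>x \<in> carrier M. \<theta> x \<in> carrier M \<rightarrow> carrier M"
    and s: "\<forall>x \<in> carrier M. \<forall>y \<in> carrier M. s (x, y) = (x \<otimes> y, \<theta> x y)"
    and sol: "pentagon_solution (carrier M) s"
  then have \<theta>: "\<theta> x y \<in> carrier M" if "x \<in> carrier M" "y \<in> carrier M" for x y
    using that by blast
  have one: "\<theta> \<one> \<one> = \<one>"
    by (rule pentagon_solution_imp_coboundary[of \<theta> s]; use \<theta> s sol in simp)
  have cob: "\<theta> x y = inv (\<theta> \<one> x) \<otimes> \<theta> \<one> (x \<otimes> y)"
      if "x \<in> carrier M" "y \<in> carrier M" for x y
    by (rule pentagon_solution_imp_coboundary[of \<theta> s]; use \<theta> s sol that in simp)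
  have form: "s (x, y) = (x \<otimes> y, inv (\<theta> \<one> x) \<otimes> \<theta> \<one> (x \<otimes> y))"
    if "x \<in> carrier M" "y \<in> carrier M" for x y
    using s[rule_format, of x y] cob[of x y] that by metis
  have \<mu>: "\<theta> \<one> x \<in> carrier M" if "x \<in> carrier M" for x
    using \<theta> that by simp
  have "transversal_map (\<theta> \<one>)"
    using pentagon_solution_coboundary_iff[of "\<theta> \<one>" s] \<mu> form sol by blast
  note fibre = transversal_map_fibre[OF \<mu> this one]
  define K where "K = {k \<in> carrier M. \<theta> \<one> k = \<one>}"
  have "\<one> \<in> \<theta> \<one> ` carrier M"
    using one by (metis image_eqI one_closed)
  then show "\<exists>K. K \<lhd> M \<and>
             representative_system M K (\<theta> \<one> ` carrier M) \<and>
             \<one> \<in> \<theta> \<one> ` carrier M \<and>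
             (\<forall>x \<in> carrier M. \<theta> \<one> x \<in> K #> x) \<and>
             (\<forall>x \<in> carrier M. \<forall>y \<in> carrier M.
                s (x, y) = (x \<otimes> y, inv (\<theta> \<one> x) \<otimes> \<theta> \<one> (x \<otimes> y)))"
    by (intro exI[of _ K] conjI ballI fibre[folded K_def] form)
qed

end
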